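(* Let $T$ be an ergodic automorphism with discrete spectrum, realized as an ergodic translation $Tx=x+g$ on a compact abelian group $G$ with normalized Haar measure $m$, and let $\rho$ be either a bounded admissible metric on $(G,m)$ or, more generally, an admissible metric for which the average metric $\hat\rho^T$ is admissible. Then the scaling sequence for $T$ and $\rho$ is bounded, i.e. for every $\varepsilon>0$ the sequence $n\mapsto H_{\hat\rho_n,\varepsilon}(m)$ is bounded.
   Context: $\hat\rho_n(x,y)=\frac1n\sum_{k=0}^{n-1}\rho(T^kx,T^ky)$ and $\hat\rho^T=\lim_n\hat\rho_n$ (a.e.). A measurable $\rho$ is an admissible metric if (1) it is a metric in the usual sense on a set of full measure and $\int\int\rho\,dm\,dm<\infty$, and (2) the completion of $(G,\rho)$ is a Polish space on which $m$ is a Borel probability measure (the Borel $\sigma$-algebra being dense mod $0$ in the measurable $\sigma$-algebra). For an admissible (semi)metric $\theta$, $H_{\theta,\varepsilon}(m)=\inf\{H(\nu):k_\theta(\nu,m)<\varepsilon\}$, where $\nu=\sum_ic_i\delta_{x_i}$ ranges over discrete measures with finite entropy $H(\nu)=-\sum_ic_i\ln c_i$ and $k_\theta$ is the Kantorovich (transportation) metric for the cost $\theta$. The class of scaling sequences for $T,\rho,\varepsilon$ is the set of increasing positive sequences $(c_n)$ with $0<\liminf_n H_{\hat\rho_n,\varepsilon}(m)/c_n\le\limsup_n H_{\hat\rho_n,\varepsilon}(m)/c_n<\infty$; "the scaling sequence is bounded" means these entropies stay bounded in $n$. *)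

theory Defs
  imports "HOL-Probability.Probability"
begin

definition haar_prob :: "'g::{topological_ab_group_add,t2_space} measure \<Rightarrow> bool" where
  "haar_prob m \<longleftrightarrow> compact (UNIV :: 'g set) \<and> sets m = sets borel \<and> prob_space m \<and>
     (\<forall>A\<in>sets m. \<forall>a. measure m ((\<lambda>x. a + x) -` A) = measure m A)"

definition ergodic_map :: "'a measure \<Rightarrow> ('a \<Rightarrow> 'a) \<Rightarrow> bool" where
  "ergodic_map m T \<longleftrightarrow> T \<in> measurable m m \<and> distr m m T = m \<and>
     (\<forall>A\<in>sets m. T -` A \<inter> space m = A \<longrightarrow> measure m A = 0 \<or> measure m A = 1)"

text \<open>Admissible semimetric: a semimetric on a set X of full measure, integrable on m x m,
  such that (X, theta) is separable (so its completion, after identifying points at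
  distance 0, is Polish), theta-balls are measurable (m is Borel) and the sigma-algebra
  generated by theta-balls is dense mod 0 in the measurable sigma-algebra.\<close>
definition theta_ball :: "'a set \<Rightarrow> ('a \<Rightarrow> 'a \<Rightarrow> real) \<Rightarrow> 'a \<Rightarrow> real \<Rightarrow> 'a set" where
  "theta_ball X \<theta> x r = {y\<in>X. \<theta> x y < r}"

definition admissible_semimetric_on :: "'a measure \<Rightarrow> ('a \<Rightarrow> 'a \<Rightarrow> real) \<Rightarrow> 'a set \<Rightarrow> bool" where
  "admissible_semimetric_on m \<theta> X \<longleftrightarrow>
     X \<in> sets m \<and> emeasure m (space m - X) = 0 \<and>
     case_prod \<theta> \<in> borel_measurable (m \<Otimes>\<^sub>M m) \<and>
     integrable (m \<Otimes>\<^sub>M m) (case_prod \<theta>) \<and>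
     (\<forall>x\<in>X. \<forall>y\<in>X. \<theta> x y \<ge> 0 \<and> \<theta> x y = \<theta> y x) \<and>
     (\<forall>x\<in>X. \<theta> x x = 0) \<and>
     (\<forall>x\<in>X. \<forall>y\<in>X. \<forall>z\<in>X. \<theta> x z \<le> \<theta> x y + \<theta> y z) \<and>
     (\<exists>D\<subseteq>X. countable D \<and> (\<forall>x\<in>X. \<forall>e>0. \<exists>d\<in>D. \<theta> x d < e)) \<and>
     (\<forall>x\<in>X. \<forall>r. theta_ball X \<theta> x r \<in> sets m) \<and>
     (\<forall>A\<in>sets m. \<exists>B\<in>sigma_sets X {theta_ball X \<theta> x r | x r. x \<in> X}.
         emeasure m ((A - B) \<union> (B - A)) = 0)"

definition admissible_semimetric :: "'a measure \<Rightarrow> ('a \<Rightarrow> 'a \<Rightarrow> real) \<Rightarrow> bool" where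
  "admissible_semimetric m \<theta> \<longleftrightarrow> (\<exists>X. admissible_semimetric_on m \<theta> X)"

definition admissible_metric :: "'a measure \<Rightarrow> ('a \<Rightarrow> 'a \<Rightarrow> real) \<Rightarrow> bool" where
  "admissible_metric m \<theta> \<longleftrightarrow>
     (\<exists>X. admissible_semimetric_on m \<theta> X \<and> (\<forall>x\<in>X. \<forall>y\<in>X. \<theta> x y = 0 \<longrightarrow> x = y))"

definition avg_metric :: "('a \<Rightarrow> 'a) \<Rightarrow> ('a \<Rightarrow> 'a \<Rightarrow> real) \<Rightarrow> nat \<Rightarrow> 'a \<Rightarrow> 'a \<Rightarrow> real" where
  "avg_metric T \<rho> n x y = (1 / real n) * (\<Sum>k<n. \<rho> ((T ^^ k) x) ((T ^^ k) y))"

definition limit_avg_metric :: "('a \<Rightarrow> 'a) \<Rightarrow> ('a \<Rightarrow> 'a \<Rightarrow> real) \<Rightarrow> 'a \<Rightarrow> 'a \<Rightarrow> real" where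
  "limit_avg_metric T \<rho> x y = lim (\<lambda>n. avg_metric T \<rho> n x y)"

definition discrete_on :: "'a measure \<Rightarrow> 'a pmf \<Rightarrow> 'a measure" where
  "discrete_on m p = distr (measure_pmf p) m id"

definition entropy_pmf :: "'a pmf \<Rightarrow> ennreal" where
  "entropy_pmf p = (\<integral>\<^sup>+ x. ennreal (- pmf p x * ln (pmf p x)) \<partial>count_space (set_pmf p))"

definition couplings :: "'a measure \<Rightarrow> 'b measure \<Rightarrow> ('a \<times> 'b) measure set" where
  "couplings \<mu> \<nu> = {\<pi>. sets \<pi> = sets (\<mu> \<Otimes>\<^sub>M \<nu>) \<and> distr \<pi> \<mu> fst = \<mu> \<and> distr \<pi> \<nu> snd = \<nu>}"

definition kantorovich :: "('a \<Rightarrow> 'a \<Rightarrow> real) \<Rightarrow> 'a measure \<Rightarrow> 'a measure \<Rightarrow> ennreal" where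
  "kantorovich \<theta> \<mu> \<nu> = (INF \<pi>\<in>couplings \<mu> \<nu>. \<integral>\<^sup>+ z. ennreal (\<theta> (fst z) (snd z)) \<partial>\<pi>)"

definition eps_entropy :: "('a \<Rightarrow> 'a \<Rightarrow> real) \<Rightarrow> real \<Rightarrow> 'a measure \<Rightarrow> ennreal" where
  "eps_entropy \<theta> \<epsilon> m = (INF p\<in>{p. entropy_pmf p < \<infinity> \<and>
        kantorovich \<theta> (discrete_on m p) m < ennreal \<epsilon>}. entropy_pmf p)"

end

theory Submission
  imports Defs
begin

text \<open>
  Averaging the cost \<open>\<rho>\<close> over a common translation gives \<open>F(a, b) = \<integral> \<rho>(x + a, x + b) dm(x)\<close>, and by
  invariance of \<open>m\<close> the averaged metrics \<open>\<rho>\<^sub>n\<close> have the same mean \<open>\<integral> \<rho>\<^sub>n(y + a, y + b) dm(y) = F(a, b)\<close>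
  for every \<open>n\<close>. Hence a finite-valued map \<open>\<psi>\<close> with \<open>\<integral> F(\<psi> z, z) dm(z) < \<epsilon>\<close> serves all \<open>n\<close> at once: by
  Fubini some \<open>y\<close> (depending on \<open>n\<close>) satisfies \<open>\<integral> \<rho>\<^sub>n(y + \<psi> z, y + z) dm(z) < \<epsilon>\<close>, so the law of \<open>y + \<psi>\<close>
  is \<open>\<epsilon>\<close>-close to \<open>m\<close> and its number of atoms does not depend on \<open>n\<close>.

  Such a \<open>\<psi>\<close> exists because \<open>\<rho>\<close> is approximated in the mean by its values on a finite measurable
  partition, and the translates of a Borel set form a separable subset of the measure algebra.

  Neither regularity of \<open>m\<close> nor metrizability of the group is assumed, and without the latter
  addition need not be measurable for the product \<open>\<sigma>\<close>-algebra. Second countability is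
  derived: if the measure algebra is separable, countably many continuous functions, dense enough
  in the \<open>L\<^sup>1\<close>-distance, are simultaneously invariant only under translation by \<open>0\<close>.
\<close>

section \<open>Separability of the measure algebra\<close>

text \<open>Names for the finite Boolean combinations of a sequence of generators. Since the
  datatype is countable, \<open>from_nat\<close> enumerates the generated algebra at once.\<close>

datatype set_expr = SEmpty | SGen nat | SCompl set_expr | SUnion set_expr set_expr

instance set_expr :: countable
  by countable_datatype

primrec eval_set :: "'a set \<Rightarrow> (nat \<Rightarrow> 'a set) \<Rightarrow> set_expr \<Rightarrow> 'a set" where
  "eval_set X E SEmpty = {}"
| "eval_set X E (SGen i) = E i"
| "eval_set X E (SCompl a) = X - eval_set X E a"
| "eval_set X E (SUnion a b) = eval_set X E a \<union> eval_set X E b"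

lemma eval_set_measurable:
  assumes "X \<in> sets M" "range E \<subseteq> sets M"
  shows "eval_set X E e \<in> sets M"
  using assms by (induction e) auto

text \<open>Sets approximable in measure by Boolean expressions are closed under complement and
  countable union, so induction over \<open>sigma_sets\<close> applies.\<close>

lemma (in finite_measure) sigma_sets_approx_eval_set:
  fixes E :: "nat \<Rightarrow> 'a set"
  assumes X: "X \<in> sets M" and E: "range E \<subseteq> sets M"
    and B: "B \<in> sigma_sets X (range E)" and \<eta>: "\<eta> > 0"
  shows "\<exists>e. measure M (sym_diff B (eval_set X E e)) < \<eta>"
proof -
  have sub: "sigma_sets X (range E) \<subseteq> sets M"
    using sets.sigma_sets_subset'[OF E X] .
  note ev[measurable] = eval_set_measurable[OF X E]
  show ?thesis
    using B \<eta>
  proof (induction arbitrary: \<eta>)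
    case (Basic a)
    then obtain i where "a = E i" by auto
    with Basic show ?case by (intro exI[of _ "SGen i"]) simp
  next
    case Empty
    then show ?case by (intro exI[of _ SEmpty]) simp
  next
    case (Compl a)
    then obtain e where e: "measure M (sym_diff a (eval_set X E e)) < \<eta>" by blast
    have [measurable]: "a \<in> sets M" using Compl sub by auto
    have "measure M (sym_diff (X - a) (X - eval_set X E e)) \<le> measure M (sym_diff a (eval_set X E e))"
      by (intro finite_measure_mono) auto
    with e show ?case by (intro exI[of _ "SCompl e"]) simp
  next
    case (Union a)
    have [measurable]: "a i \<in> sets M" for i using Union(1) sub by blast
    \<comment> \<open>Finite unions first: at each step half of the error goes to the earlier union
      and half to the new member.\<close>
    have fin: "\<exists>e. measure M (sym_diff (\<Union>i<n. a i) (eval_set X E e)) < t" if "t > 0" for n and t :: real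
      using that
    proof (induction n arbitrary: t)
      case 0
      then show ?case by (intro exI[of _ SEmpty]) simp
    next
      case (Suc n)
      obtain e where e: "measure M (sym_diff (\<Union>i<n. a i) (eval_set X E e)) < t / 2"
        using Suc.IH[of "t / 2"] Suc.prems by auto
      obtain f where f: "measure M (sym_diff (a n) (eval_set X E f)) < t / 2"
        using Union(2)[of "t / 2" n] Suc.prems by auto
      have "measure M (sym_diff (\<Union>i<Suc n. a i) (eval_set X E (SUnion e f)))
          \<le> measure M (sym_diff (\<Union>i<n. a i) (eval_set X E e) \<union> sym_diff (a n) (eval_set X E f))"
        by (intro finite_measure_mono) (auto simp: lessThan_Suc)
      also have "\<dots> \<le> measure M (sym_diff (\<Union>i<n. a i) (eval_set X E e)) + measure M (sym_diff (a n) (eval_set X E f))"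
        by (intro measure_Un_le) auto
      finally show ?case using e f by (intro exI[of _ "SUnion e f"]) simp
    qed
    \<comment> \<open>Continuity from below: cutting the union to finitely many members costs less
      than half of \<open>\<eta>\<close>; the other half goes to \<open>fin\<close>.\<close>
    have "(\<lambda>n. measure M (\<Union>i<n. a i)) \<longlonglongrightarrow> measure M (\<Union>n. \<Union>i<n. a i)"
      by (intro finite_Lim_measure_incseq) (auto simp: incseq_def intro: less_le_trans)
    also have "(\<Union>n. \<Union>i<n. a i) = \<Union>(range a)" by auto
    finally have "\<forall>\<^sub>F n in sequentially. measure M (\<Union>(range a)) - \<eta> / 2 < measure M (\<Union>i<n. a i)"
      using Union.prems by (intro order_tendstoD) auto
    then obtain n where n: "measure M (\<Union>(range a)) - \<eta> / 2 < measure M (\<Union>i<n. a i)"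
      by (auto simp: eventually_sequentially)
    have d: "measure M (\<Union>(range a) - (\<Union>i<n. a i)) = measure M (\<Union>(range a)) - measure M (\<Union>i<n. a i)"
      by (intro finite_measure_Diff) auto
    obtain e where e: "measure M (sym_diff (\<Union>i<n. a i) (eval_set X E e)) < \<eta> / 2"
      using fin[of "\<eta> / 2"] Union.prems by auto
    have "measure M (sym_diff (\<Union>(range a)) (eval_set X E e))
          \<le> measure M ((\<Union>(range a) - (\<Union>i<n. a i)) \<union> sym_diff (\<Union>i<n. a i) (eval_set X E e))"
      by (intro finite_measure_mono) auto
    also have "\<dots> \<le> measure M (\<Union>(range a) - (\<Union>i<n. a i)) + measure M (sym_diff (\<Union>i<n. a i) (eval_set X E e))"
      by (intro measure_Un_le) auto
    finally show ?case using e n d by (intro exI[of _ e]) simp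
  qed
qed

text \<open>Separability for the pseudometric \<open>measure M (sym_diff A B)\<close>, given by a
  sequence so that a least good index can later be chosen measurably.\<close>

definition dense_in_measure_algebra :: "'a measure \<Rightarrow> (nat \<Rightarrow> 'a set) \<Rightarrow> bool" where
  "dense_in_measure_algebra M A \<longleftrightarrow> range A \<subseteq> sets M \<and>
     (\<forall>B\<in>sets M. \<forall>\<eta>>0. \<exists>i. measure M (sym_diff B (A i)) < \<eta>)"

lemma (in finite_measure) exists_dense_in_measure_algebra:
  fixes E :: "nat \<Rightarrow> 'a set"
  assumes X: "X \<in> sets M" and E: "range E \<subseteq> sets M"
    and dense: "\<And>B. B \<in> sets M \<Longrightarrow> \<exists>B'\<in>sigma_sets X (range E). emeasure M (sym_diff B B') = 0"
  shows "\<exists>A. dense_in_measure_algebra M A"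
proof -
  note ev[measurable] = eval_set_measurable[OF X E]
  have sub: "sigma_sets X (range E) \<subseteq> sets M"
    using sets.sigma_sets_subset'[OF E X] .
  have "\<exists>i. measure M (sym_diff B (eval_set X E (from_nat i))) < \<eta>"
    if B[measurable]: "B \<in> sets M" and \<eta>: "\<eta> > 0" for B \<eta>
  proof -
    obtain B' where B': "B' \<in> sigma_sets X (range E)" "emeasure M (sym_diff B B') = 0"
      using dense[OF B] by blast
    have [measurable]: "B' \<in> sets M" using B' sub by auto
    obtain e where e: "measure M (sym_diff B' (eval_set X E e)) < \<eta>"
      using sigma_sets_approx_eval_set[OF X E B'(1) \<eta>] by blast
    have "measure M (sym_diff B (eval_set X E e)) \<le> measure M (sym_diff B B' \<union> sym_diff B' (eval_set X E e))"
      by (intro finite_measure_mono) auto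
    also have "\<dots> \<le> measure M (sym_diff B B') + measure M (sym_diff B' (eval_set X E e))"
      by (intro measure_Un_le) auto
    also have "measure M (sym_diff B B') = 0" using B'(2) by (simp add: measure_def)
    finally show ?thesis using e by (intro exI[of _ "to_nat e"]) simp
  qed
  then show ?thesis
    by (intro exI[of _ "\<lambda>i. eval_set X E (from_nat i)"]) (auto simp: dense_in_measure_algebra_def)
qed

text \<open>Every ball is a countable union of balls with centres in a countable dense set and
  rational radii. These countably many balls therefore generate all that the balls generate, and the
  mod 0 clause of admissibility carries the approximation over to all of
  \<open>sets m\<close>.\<close>

lemma admissible_imp_dense_in_measure_algebra:
  assumes "finite_measure m" and adm: "admissible_semimetric_on m \<theta> X" and "X \<noteq> {}"
  shows "\<exists>A. dense_in_measure_algebra m A"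
proof -
  interpret finite_measure m by fact
  have pos: "\<And>x y. x \<in> X \<Longrightarrow> y \<in> X \<Longrightarrow> \<theta> x y = \<theta> y x"
    and tri: "\<And>x y z. x \<in> X \<Longrightarrow> y \<in> X \<Longrightarrow> z \<in> X \<Longrightarrow> \<theta> x z \<le> \<theta> x y + \<theta> y z"
    and X: "X \<in> sets m"
    and ball: "\<And>x r. x \<in> X \<Longrightarrow> theta_ball X \<theta> x r \<in> sets m"
    and gen: "\<And>A. A \<in> sets m \<Longrightarrow> \<exists>B\<in>sigma_sets X {theta_ball X \<theta> x r | x r. x \<in> X}. emeasure m (sym_diff A B) = 0"
    using adm unfolding admissible_semimetric_on_def by auto
  obtain D where D: "D \<subseteq> X" "countable D" and dense: "\<And>x e. x \<in> X \<Longrightarrow> e > 0 \<Longrightarrow> \<exists>d\<in>D. \<theta> x d < e"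
    using adm unfolding admissible_semimetric_on_def by auto
  have "D \<noteq> {}" using dense[of _ 1] \<open>X \<noteq> {}\<close> by force
  define E where "E = (\<lambda>i. case prod_decode i of (i, j) \<Rightarrow> theta_ball X \<theta> (from_nat_into D i) (real_of_rat (from_nat j)))"
  have E_I: "theta_ball X \<theta> d (real_of_rat q) \<in> range E" if "d \<in> D" for d q
    using that D by (intro range_eqI[of _ _ "prod_encode (to_nat_on D d, to_nat q)"]) (simp add: E_def)
  have "from_nat_into D i \<in> X" for i
    using from_nat_into[OF \<open>D \<noteq> {}\<close>] D(1) by blast
  then have E: "range E \<subseteq> sets m"
    by (auto simp: E_def ball split: prod.splits)
  have "theta_ball X \<theta> x r \<in> sigma_sets X (range E)" if x: "x \<in> X" for x r
  proof -
    have "\<exists>W\<in>range E. y \<in> W \<and> W \<subseteq> theta_ball X \<theta> x r" if y: "y \<in> theta_ball X \<theta> x r" for y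
    proof -
      from y have y: "y \<in> X" "\<theta> x y < r" by (auto simp: theta_ball_def)
      \<comment> \<open>With s = r - \<open>\<theta> x y\<close>, the centre lies within s/3 of
        \<open>y\<close> and the radius lies between s/3 and 2s/3. The small ball thus contains
        \<open>y\<close>, and its points stay at distance less than \<open>r\<close> from
        \<open>x\<close>.\<close>
      obtain d where d: "d \<in> D" "\<theta> y d < (r - \<theta> x y) / 3" using dense[OF y(1), of "(r - \<theta> x y) / 3"] y by auto
      obtain q where q: "(r - \<theta> x y) / 3 < real_of_rat q" "real_of_rat q < 2 * (r - \<theta> x y) / 3"
        using of_rat_dense[of "(r - \<theta> x y) / 3" "2 * (r - \<theta> x y) / 3"] y by auto
      have dX: "d \<in> X" using d D by auto
      show ?thesis
      proof (intro bexI[OF _ E_I[OF d(1)]] conjI)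
        show "y \<in> theta_ball X \<theta> d (real_of_rat q)"
          using d q y dX pos[of y d] by (auto simp: theta_ball_def)
        show "theta_ball X \<theta> d (real_of_rat q) \<subseteq> theta_ball X \<theta> x r"
        proof
          fix z assume "z \<in> theta_ball X \<theta> d (real_of_rat q)"
          then have z: "z \<in> X" "\<theta> d z < real_of_rat q" by (auto simp: theta_ball_def)
          have "\<theta> x z \<le> \<theta> x y + \<theta> y d + \<theta> d z"
            using tri[OF x y(1) z(1)] tri[OF y(1) dX z(1)] by simp
          then show "z \<in> theta_ball X \<theta> x r" using z q d by (auto simp: theta_ball_def)
        qed
      qed
    qed
    then have eq: "theta_ball X \<theta> x r = \<Union>{W \<in> range E. W \<subseteq> theta_ball X \<theta> x r}" by blast
    have "countable {W \<in> range E. W \<subseteq> theta_ball X \<theta> x r}" by (rule countable_subset[of _ "range E"]) auto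
    then show ?thesis
      by (subst eq) (rule sigma_sets_UNION, auto)
  qed
  then have "sigma_sets X {theta_ball X \<theta> x r | x r. x \<in> X} \<subseteq> sigma_sets X (range E)"
    by (intro sigma_sets_mono) auto
  with gen show ?thesis
    by (intro exists_dense_in_measure_algebra[OF X E]) blast
qed

section \<open>Second countability of the group\<close>

lemma compact_t2_Urysohn:
  fixes a b :: "'a::t2_space"
  assumes "compact (UNIV :: 'a set)" "a \<noteq> b"
  obtains f :: "'a \<Rightarrow> real" where "continuous_on UNIV f" "f a = 0" "f b = 1"
proof -
  have "Hausdorff_space (euclidean :: 'a topology)"
    by (auto simp: Hausdorff_space_def disjnt_def separation_t2)
  moreover have "compact_space (euclidean :: 'a topology)"
    using assms by (simp add: compact_space_def)
  ultimately have "normal_space (euclidean :: 'a topology)"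
    using compact_Hausdorff_or_regular_imp_normal_space by blast
  then obtain f :: "'a \<Rightarrow> real" where "continuous_map euclidean euclideanreal f" "f ` {a} \<subseteq> {0}" "f ` {b} \<subseteq> {1}"
    using Urysohn_lemma_alt[of "euclidean :: 'a topology" "{a}" "{b}" 0 1] assms by (auto simp: disjnt_def)
  with that show thesis by simp
qed

section \<open>Translation invariance of the Haar measure and L1 approximation\<close>

locale haar_measure =
  fixes m :: "'g::{topological_ab_group_add,t2_space} measure"
  assumes haar: "haar_prob m"
begin

sublocale prob_space m
  using haar by (simp add: haar_prob_def)

lemma compact_group: "compact (UNIV :: 'g set)"
  using haar by (simp add: haar_prob_def)

lemma sets_m [measurable_cong, simp]: "sets m = sets borel"
  using haar by (simp add: haar_prob_def)

lemma space_m [simp]: "space m = UNIV"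
  using sets_eq_imp_space_eq[OF sets_m] by simp

lemma measurable_translate [measurable]: "(\<lambda>x. x + a :: 'g) \<in> borel_measurable borel"
  by (intro borel_measurable_continuous_onI continuous_intros)

lemma distr_translate: "distr m borel (\<lambda>x. x + a) = m"
proof (rule measure_eqI)
  fix A assume "A \<in> sets (distr m borel (\<lambda>x. x + a))"
  then have A[measurable]: "A \<in> sets borel" by simp
  have "measure m ((\<lambda>x. a + x) -` A) = measure m A"
    using haar A by (auto simp: haar_prob_def)
  then show "emeasure (distr m borel (\<lambda>x. x + a)) A = emeasure m A"
    by (simp add: emeasure_distr emeasure_eq_measure add.commute)
qed simp

lemma nn_integral_translate:
  assumes [measurable]: "f \<in> borel_measurable borel"
  shows "(\<integral>\<^sup>+x. f (x + a) \<partial>m) = (\<integral>\<^sup>+x. f x \<partial>m)"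
proof -
  have "(\<integral>\<^sup>+x. f x \<partial>m) = (\<integral>\<^sup>+x. f x \<partial>distr m borel (\<lambda>x. x + a))"
    by (simp add: distr_translate)
  also have "\<dots> = (\<integral>\<^sup>+x. f (x + a) \<partial>m)"
    by (intro nn_integral_distr) auto
  finally show ?thesis ..
qed

lemma measure_translate:
  assumes [measurable]: "A \<in> sets borel"
  shows "measure m ((\<lambda>x. x + a) -` A) = measure m A"
  using measure_distr[of "\<lambda>x. x + a" m borel A] by (simp add: distr_translate)

lemma open_translate: "open U \<Longrightarrow> open ((\<lambda>x. x + a :: 'g) -` U)"
  by (intro open_vimage continuous_intros)

lemma finite_translate_cover:
  assumes "open U" "u \<in> U"
  obtains E :: "'g set" where "finite E" "(\<Union>e\<in>E. (\<lambda>x. x + e) -` U) = UNIV"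
proof -
  have "\<exists>D\<subseteq>UNIV. finite D \<and> UNIV \<subseteq> (\<Union>e\<in>D. (\<lambda>x. x + e :: 'g) -` U)"
  proof (rule compactE_image[OF compact_group, of UNIV "\<lambda>e. (\<lambda>x. x + e) -` U"])
    show "UNIV \<subseteq> (\<Union>e. (\<lambda>x. x + e) -` U)"
    proof
      fix x show "x \<in> (\<Union>e. (\<lambda>x. x + e) -` U)" using assms by (auto intro!: exI[of _ "u - x"])
    qed
  qed (use open_translate[OF assms(1)] in auto)
  with that show thesis by auto
qed

text \<open>By compactness finitely many translates of \<open>U\<close> cover the group. All have
  the measure of \<open>U\<close>, so a null \<open>U\<close> would make the whole group
  null.\<close>

lemma open_measure_pos:
  assumes "open U" "u \<in> U"
  shows "measure m U > 0"
proof (rule ccontr)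
  assume "\<not> measure m U > 0"
  then have 0: "measure m U = 0" using measure_nonneg[of m U] by linarith
  obtain E where E: "finite E" "(\<Union>e\<in>E. (\<lambda>x. x + e) -` U) = UNIV"
    using finite_translate_cover[OF assms] .
  have [measurable]: "U \<in> sets borel" using assms by auto
  have "measure m (\<Union>e\<in>E. (\<lambda>x. x + e) -` U) \<le> (\<Sum>e\<in>E. measure m ((\<lambda>x. x + e) -` U))"
    using assms(1) by (intro finite_measure_subadditive_finite E) (auto intro!: borel_open open_translate)
  then show False
    using prob_space by (simp add: E measure_translate 0)
qed

text \<open>For sets of the form f > 0 the continuous approximants are explicit:
  \<open>min 1 (k * max 0 f)\<close> converges pointwise to the indicator and stays within [0, 1],
  so dominated convergence applies.\<close>

lemma L1_approx_indicator:
  fixes f :: "'g \<Rightarrow> real"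
  assumes f: "continuous_on UNIV f" and "\<eta> > 0"
  obtains g :: "'g \<Rightarrow> real" where "continuous_on UNIV g"
    "(\<integral>\<^sup>+x. ennreal \<bar>g x - indicator {x. f x > 0} x\<bar> \<partial>m) < ennreal \<eta>"
proof -
  have [measurable]: "f \<in> borel_measurable borel"
    using f by (rule borel_measurable_continuous_onI)
  define g where "g k x = min 1 (real k * max 0 (f x))" for k x
  have "(\<lambda>k. \<integral>\<^sup>+x. ennreal \<bar>g k x - indicator {x. f x > 0} x\<bar> \<partial>m) \<longlonglongrightarrow> (\<integral>\<^sup>+x. 0 \<partial>m)"
  proof (rule nn_integral_dominated_convergence[where w="\<lambda>_. 1"])
    show "AE x in m. (\<lambda>k. ennreal \<bar>g k x - indicator {x. f x > 0} x\<bar>) \<longlonglongrightarrow> 0"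
    proof (intro AE_I2)
      fix x
      show "(\<lambda>k. ennreal \<bar>g k x - indicator {x. f x > 0} x\<bar>) \<longlonglongrightarrow> 0"
      proof (cases "f x > 0")
        case True
        obtain k0 :: nat where k0: "1 / f x < real k0" using reals_Archimedean2 by blast
        have "g k x = 1" if "k \<ge> k0" for k
        proof -
          have "1 < real k0 * f x" using k0 True by (simp add: field_simps)
          also have "\<dots> \<le> real k * f x" using that True by (intro mult_right_mono) auto
          finally show ?thesis using True by (simp add: g_def)
        qed
        then show ?thesis using True
          by (intro tendsto_eventually) (auto simp: eventually_sequentially)
      qed (simp add: g_def)
    qed
    show "AE x in m. ennreal \<bar>g k x - indicator {x. f x > 0} x\<bar> \<le> 1" for k
    proof (intro AE_I2)
      fix x
      have "0 \<le> real k * max 0 (f x)" by simp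
      then show "ennreal \<bar>g k x - indicator {x. f x > 0} x\<bar> \<le> 1"
        by (auto simp: g_def indicator_def min_def simp flip: ennreal_1 intro!: ennreal_leI)
    qed
    show "(\<integral>\<^sup>+x. 1 \<partial>m) < \<infinity>" by (simp add: emeasure_space_1[simplified])
  qed (auto simp: g_def)
  then have "\<forall>\<^sub>F k in sequentially. (\<integral>\<^sup>+x. ennreal \<bar>g k x - indicator {x. f x > 0} x\<bar> \<partial>m) < ennreal \<eta>"
    using \<open>\<eta> > 0\<close> by (intro order_tendstoD) auto
  then obtain k where "(\<integral>\<^sup>+x. ennreal \<bar>g k x - indicator {x. f x > 0} x\<bar> \<partial>m) < ennreal \<eta>"
    by (auto simp: eventually_sequentially)
  moreover have "continuous_on UNIV (g k)"
    unfolding g_def by (intro continuous_intros f)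
  ultimately show thesis using that by blast
qed

lemma nn_integral_abs_diff_triangle:
  fixes f g h :: "'g \<Rightarrow> real"
  assumes [measurable]: "f \<in> borel_measurable borel" "g \<in> borel_measurable borel" "h \<in> borel_measurable borel"
  shows "(\<integral>\<^sup>+x. ennreal \<bar>f x - h x\<bar> \<partial>m) \<le> (\<integral>\<^sup>+x. ennreal \<bar>f x - g x\<bar> \<partial>m) + (\<integral>\<^sup>+x. ennreal \<bar>g x - h x\<bar> \<partial>m)"
proof -
  have "(\<integral>\<^sup>+x. ennreal \<bar>f x - h x\<bar> \<partial>m) \<le> (\<integral>\<^sup>+x. ennreal \<bar>f x - g x\<bar> + ennreal \<bar>g x - h x\<bar> \<partial>m)"
    by (intro nn_integral_mono) (auto simp flip: ennreal_plus intro!: ennreal_leI)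
  then show ?thesis by (simp add: nn_integral_add)
qed

lemma nn_integral_indicator_diff:
  assumes [measurable]: "A \<in> sets borel" "B \<in> sets borel"
  shows "(\<integral>\<^sup>+x. ennreal \<bar>indicator A x - indicator B x\<bar> \<partial>m) = ennreal (measure m (sym_diff A B))"
proof -
  have "(\<integral>\<^sup>+x. ennreal \<bar>indicator A x - indicator B x\<bar> \<partial>m) = (\<integral>\<^sup>+x. indicator (sym_diff A B) x \<partial>m)"
    by (intro nn_integral_cong) (auto simp: indicator_def)
  then show ?thesis by (simp add: emeasure_eq_measure)
qed

text \<open>For each \<open>A i\<close> and each precision one continuous function near the
  indicator of \<open>A i\<close> is kept, if there is one. If all of these were invariant under
  some \<open>h\<close> different from 0, every set f > 0 with f continuous would be almost
  invariant under \<open>h\<close>. A Urysohn function separating 0 from \<open>h\<close> gives such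
  a set that differs from its translate on a nonempty open set, which has positive measure.\<close>

lemma countable_translation_separating:
  assumes A: "dense_in_measure_algebra m A"
  obtains F :: "nat \<Rightarrow> 'g \<Rightarrow> real"
    where "\<And>j. continuous_on UNIV (F j)" "\<And>h. (\<And>j x. F j (x + h) = F j x) \<Longrightarrow> h = 0"
proof -
  have [measurable]: "A i \<in> sets borel" for i
    using A by (auto simp: dense_in_measure_algebra_def)
  define P where "P i n f \<longleftrightarrow> continuous_on UNIV f \<and>
    (\<integral>\<^sup>+x. ennreal \<bar>f x - indicator (A i) x\<bar> \<partial>m) < ennreal (1 / Suc n)" for i n and f :: "'g \<Rightarrow> real"
  \<comment> \<open>The default 0 keeps every \<open>F j\<close> continuous.\<close>
  define F where "F = (\<lambda>(i, n). if \<exists>f. P i n f then SOME f. P i n f else (\<lambda>_. 0))"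
  have F: "P i n (F (i, n))" if "P i n f" for i n f
    using that someI_ex[of "P i n"] by (auto simp: F_def)
  have cont: "continuous_on UNIV (F j)" for j
  proof (cases "\<exists>f. P (fst j) (snd j) f")
    case True
    then show ?thesis using F[of "fst j" "snd j"] by (auto simp: P_def)
  next
    case False
    then have "F j = (\<lambda>_. 0)" by (auto simp: F_def case_prod_beta)
    then show ?thesis by simp
  qed
  have [measurable]: "F j \<in> borel_measurable borel" for j
    using cont by (rule borel_measurable_continuous_onI)
  have sep: "h = 0" if inv: "\<And>j x. F j (x + h) = F j x" for h
  proof (rule ccontr)
    assume "h \<noteq> 0"
    then obtain f0 :: "'g \<Rightarrow> real" where f0: "continuous_on UNIV f0" "f0 0 = 0" "f0 h = 1"
      using compact_t2_Urysohn[OF compact_group, of 0 h] by metis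
    \<comment> \<open>The shift makes \<open>f\<close> negative at 0 and positive at
      \<open>h\<close>, both of which are open conditions.\<close>
    define f where "f x = f0 x - 1 / 2" for x
    have f: "continuous_on UNIV f" unfolding f_def by (intro continuous_intros f0)
    define O' where "O' = {x. f x > 0}"
    have "open O'" unfolding O'_def
      by (intro open_Collect_less continuous_intros f)
    then have [measurable]: "O' \<in> sets borel" by auto
    \<comment> \<open>A neighbourhood of 0 on which the indicator of \<open>O'\<close> is 0 while
      its translate by \<open>h\<close> is 1.\<close>
    define N where "N = {x. f x < 0} \<inter> (\<lambda>x. x + h) -` O'"
    have "open N" unfolding N_def
      by (intro open_Int open_translate \<open>open O'\<close> open_Collect_less continuous_intros f)
    then have [measurable]: "N \<in> sets borel" by auto
    have "0 \<in> N" using f0 by (auto simp: N_def f_def O'_def)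
    define \<beta> where "\<beta> = measure m N"
    have "\<beta> > 0" unfolding \<beta>_def using open_measure_pos[OF \<open>open N\<close> \<open>0 \<in> N\<close>] .
    \<comment> \<open>The two comparisons of \<open>G\<close>, with \<open>O'\<close> and with its
      translate, cost 3t/2 each with t = 1/(n + 1). Their sum 3t has to stay below
      \<open>\<beta>\<close>.\<close>
    then obtain n where n: "1 / real (Suc n) < \<beta> / 3"
      using reals_Archimedean[of "\<beta> / 3"] by (auto simp: inverse_eq_divide)
    define t where "t = 1 / real (Suc n)"
    have t: "t > 0" by (simp add: t_def)
    obtain g where g: "continuous_on UNIV g" "(\<integral>\<^sup>+x. ennreal \<bar>g x - indicator O' x\<bar> \<partial>m) < ennreal (t / 2)"
      using L1_approx_indicator[OF f, of "t / 2"] t unfolding O'_def by auto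
    have [measurable]: "g \<in> borel_measurable borel"
      using g by (intro borel_measurable_continuous_onI)
    obtain i where i: "measure m (sym_diff O' (A i)) < t / 2"
      using A t by (auto simp: dense_in_measure_algebra_def dest!: bspec[of _ _ O'] spec[of _ "t/2"])
    have i': "(\<integral>\<^sup>+x. ennreal \<bar>indicator O' x - indicator (A i) x\<bar> \<partial>m) < ennreal (t / 2)"
      using i t by (subst nn_integral_indicator_diff) (auto intro!: ennreal_lessI)
    have "(\<integral>\<^sup>+x. ennreal \<bar>g x - indicator (A i) x\<bar> \<partial>m) < ennreal (t / 2) + ennreal (t / 2)"
      by (rule le_less_trans[OF nn_integral_abs_diff_triangle[of _ "indicator O'"] add_strict_mono[OF g(2) i']]) auto
    also have "\<dots> = ennreal t" using t by (simp flip: ennreal_plus)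
    \<comment> \<open>The function \<open>g\<close> serves only as a witness: it ensures that
      \<open>F (i, n)\<close> is a true approximant of \<open>A i\<close> and not the
      default.\<close>
    finally have "P i n g" using g by (simp add: P_def t_def)
    define G where "G = F (i, n)"
    have [measurable]: "G \<in> borel_measurable borel" by (simp add: G_def)
    have G: "(\<integral>\<^sup>+x. ennreal \<bar>G x - indicator (A i) x\<bar> \<partial>m) < ennreal t"
      using F[OF \<open>P i n g\<close>] by (simp add: P_def t_def G_def)
    have i'': "(\<integral>\<^sup>+x. ennreal \<bar>indicator (A i) x - indicator O' x\<bar> \<partial>m) < ennreal (t / 2)"
      using i' by (simp add: abs_minus_commute)
    have "(\<integral>\<^sup>+x. ennreal \<bar>G x - indicator O' x\<bar> \<partial>m) < ennreal t + ennreal (t / 2)"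
      by (rule le_less_trans[OF nn_integral_abs_diff_triangle[of _ "indicator (A i)"] add_strict_mono[OF G i'']]) auto
    also have "\<dots> = ennreal (3 / 2 * t)" using t by (simp flip: ennreal_plus)
    finally have GO: "(\<integral>\<^sup>+x. ennreal \<bar>G x - indicator O' x\<bar> \<partial>m) < ennreal (3 / 2 * t)" .
    \<comment> \<open>Since \<open>G\<close> is invariant under \<open>h\<close>, it is as close to
      the translated indicator as to the original one.\<close>
    have "(\<integral>\<^sup>+x. ennreal \<bar>indicator O' (x + h) - G x\<bar> \<partial>m) = (\<integral>\<^sup>+x. ennreal \<bar>G (x + h) - indicator O' (x + h)\<bar> \<partial>m)"
      using inv by (simp add: G_def abs_minus_commute)
    also have "\<dots> = (\<integral>\<^sup>+x. ennreal \<bar>G x - indicator O' x\<bar> \<partial>m)"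
      by (rule nn_integral_translate[where f="\<lambda>x. ennreal \<bar>G x - indicator O' x\<bar>"]) simp
    finally have GO': "(\<integral>\<^sup>+x. ennreal \<bar>indicator O' (x + h) - G x\<bar> \<partial>m) < ennreal (3 / 2 * t)"
      using GO by simp
    have "emeasure m N = (\<integral>\<^sup>+x. indicator N x \<partial>m)" by simp
    also have "\<dots> \<le> (\<integral>\<^sup>+x. ennreal \<bar>indicator O' (x + h) - indicator O' x\<bar> \<partial>m)"
      by (intro nn_integral_mono) (auto simp: N_def O'_def indicator_def)
    also have "\<dots> < ennreal (3 / 2 * t) + ennreal (3 / 2 * t)"
      by (rule le_less_trans[OF nn_integral_abs_diff_triangle[of _ G] add_strict_mono[OF GO' GO]]) auto
    also have "\<dots> = ennreal (3 * t)" using t by (simp flip: ennreal_plus)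
    also have "\<dots> \<le> ennreal \<beta>" using n by (intro ennreal_leI) (simp add: t_def)
    finally show False by (simp add: \<beta>_def emeasure_eq_measure)
  qed
  show thesis
  proof (rule that[of "\<lambda>j. F (prod_decode j)"])
    show "h = 0" if "\<And>j x. F (prod_decode j) (x + h) = F (prod_decode j) x" for h
      by (rule sep) (metis that prod_encode_inverse)
  qed (rule cont)
qed

end

text \<open>The preimage of an open set under addition is open in the product, and a countable basis
  makes it a countable union of open rectangles. This places it in the product \<sigma>-algebra,
  which in general may be smaller than the Borel \<sigma>-algebra of the product.\<close>

lemma borel_measurable_add_countable_basis:
  fixes B :: "'g::topological_ab_group_add set set"
  assumes B: "countable B" "topological_basis B"
  shows "(\<lambda>p. fst p + snd p :: 'g) \<in> borel_measurable (borel \<Otimes>\<^sub>M borel)"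
proof (rule borel_measurableI)
  fix S :: "'g set" assume "open S"
  have "open ((\<lambda>p. fst p + snd p) -` S :: ('g \<times> 'g) set)"
    by (intro open_vimage \<open>open S\<close> continuous_intros)
  then have "\<exists>B'\<subseteq>(\<lambda>(a, b). a \<times> b) ` (B \<times> B). \<Union>B' = (\<lambda>p. fst p + snd p) -` S"
    by (rule topological_basis_prod[OF B(2) B(2), unfolded topological_basis_def, THEN conjunct2, rule_format])
  then obtain B' where B': "B' \<subseteq> (\<lambda>(a, b). a \<times> b) ` (B \<times> B)" "\<Union>B' = (\<lambda>p. fst p + snd p) -` S"
    by (elim exE conjE)
  have "countable B'"
    by (rule countable_subset[OF B'(1)]) (auto intro!: B(1))
  moreover have "W \<in> sets (borel \<Otimes>\<^sub>M borel)" if W: "W \<in> B'" for W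
  proof -
    obtain p where "p \<in> B \<times> B" "W = (\<lambda>(a, b). a \<times> b) p"
      by (rule imageE[OF subsetD[OF B'(1) W]])
    then obtain a b where "W = a \<times> b" "a \<in> B" "b \<in> B" by (cases p) simp
    then show ?thesis using topological_basis_open[OF B(2)] by (auto intro!: pair_measureI)
  qed
  ultimately have "\<Union>B' \<in> sets (borel \<Otimes>\<^sub>M borel)"
    by (intro sets.countable_Union) auto
  with B' show "(\<lambda>p. fst p + snd p) -` S \<inter> space (borel \<Otimes>\<^sub>M borel) \<in> sets (borel \<Otimes>\<^sub>M borel)"
    by (simp add: space_pair_measure)
qed

context haar_measure
begin

text \<open>The separating functions give countably many closed neighbourhoods of 0 with
  intersection {0}. By compactness open sets inside their finite intersections form a base at 0, and
  finitely many translates of each member of that base suffice for a basis of the whole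
  group.\<close>

lemma countable_basis_of_dense_sequence:
  assumes A: "dense_in_measure_algebra m A"
  shows "\<exists>B :: 'g set set. countable B \<and> topological_basis B"
proof -
  obtain F :: "nat \<Rightarrow> 'g \<Rightarrow> real"
    where F: "\<And>j. continuous_on UNIV (F j)" and sep: "\<And>h. (\<And>j x. F j (x + h) = F j x) \<Longrightarrow> h = 0"
    using countable_translation_separating[OF A] by blast
  \<comment> \<open>The translations that move \<open>F j\<close> uniformly by at most 1/(n +
    1).\<close>
  define C where "C = (\<lambda>(j, n). {h. \<forall>x. \<bar>F j (x + h) - F j x\<bar> \<le> 1 / Suc n})"
  have "closed {h. \<forall>x. \<bar>F j (x + h) - F j x\<bar> \<le> 1 / Suc n}" for j n
    by (intro closed_Collect_all closed_Collect_le continuous_intros continuous_on_compose2[OF F]) auto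
  then have closed_C: "closed (C p)" for p by (simp add: C_def split: prod.splits)
  have "\<exists>U. open U \<and> 0 \<in> U \<and> U \<subseteq> C p" for p
  proof -
    obtain j n where p: "p = (j, n)" by fastforce
    \<comment> \<open>Compactness in \<open>x\<close> makes the continuity at \<open>h\<close> = 0
      uniform in \<open>x\<close>, so \<open>C p\<close> is a neighbourhood of 0.\<close>
    have "continuous_on (UNIV \<times> UNIV) (\<lambda>(h, x). F j (x + h))"
      unfolding case_prod_beta by (intro continuous_on_compose2[OF F] continuous_intros) auto
    then obtain U where "0 \<in> U" "open U"
      "\<forall>h\<in>U \<inter> UNIV. \<forall>x\<in>UNIV. dist ((\<lambda>(h, x). F j (x + h)) (h, x)) ((\<lambda>(h, x). F j (x + h)) (0, x)) \<le> 1 / Suc n"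
      by (rule continuous_on_prod_compactE[OF _ compact_group, of UNIV _ 0 "1 / Suc n"]) auto
    then show ?thesis by (intro exI[of _ U]) (auto simp: p C_def dist_real_def)
  qed
  then obtain U where U: "\<And>p. open (U p)" "\<And>p. 0 \<in> U p" "\<And>p. U p \<subseteq> C p" by metis
  define V where "V k = (\<Inter>i<k. U (prod_decode i))" for k
  have V: "open (V k)" "0 \<in> V k" for k
    by (simp_all add: V_def U(2) open_INT U(1))
  have base: "\<exists>k. V k \<subseteq> W" if "open W" "0 \<in> W" for W
  proof (rule ccontr)
    assume neg: "\<not> (\<exists>k. V k \<subseteq> W)"
    have "compact (- W)" using compact_Int_closed[OF compact_group, of "- W"] \<open>open W\<close> by auto
    \<comment> \<open>If no \<open>V k\<close> fits into \<open>W\<close>, finite intersections of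
      the closed sets meet the compact complement of \<open>W\<close>. So does the full
      intersection, although separation reduces it to {0}.\<close>
    then have "- W \<inter> (\<Inter>i. C (prod_decode i)) \<noteq> {}"
    proof (rule compact_imp_fip_image[OF _ closed_C])
      fix I :: "nat set" assume "finite I"
      then obtain k where "I \<subseteq> {..<k}" using finite_nat_bounded by blast
      then have "V k \<subseteq> (\<Inter>i\<in>I. C (prod_decode i))" unfolding V_def using U(3) by blast
      with neg show "- W \<inter> (\<Inter>i\<in>I. C (prod_decode i)) \<noteq> {}" by blast
    qed
    then obtain h where h: "h \<notin> W" "\<And>i. h \<in> C (prod_decode i)" by blast
    have "F j (x + h) = F j x" for j x
    proof (rule ccontr)
      assume "F j (x + h) \<noteq> F j x"
      then obtain n where n: "1 / real (Suc n) < \<bar>F j (x + h) - F j x\<bar>"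
        using reals_Archimedean[of "\<bar>F j (x + h) - F j x\<bar>"] by (auto simp: inverse_eq_divide)
      show False using h(2)[of "prod_encode (j, n)"] n by (auto simp: C_def not_le[symmetric])
    qed
    then have "h = 0" by (rule sep)
    with h that show False by simp
  qed
  have "\<exists>E. finite E \<and> (\<Union>e\<in>E. (\<lambda>x. x + e) -` V k) = UNIV" for k
    using finite_translate_cover[OF V] by metis
  then obtain E where E: "\<And>k. finite (E k)" "\<And>k. (\<Union>e\<in>E k. (\<lambda>x. x + e) -` V k) = UNIV" by metis
  define B where "B = (\<Union>k. (\<lambda>e. (\<lambda>x. x + e) -` V k) ` E k)"
  have "countable B" unfolding B_def
    by (simp add: countable_finite E(1))
  moreover have "topological_basis B"
  proof (rule topological_basisI)
    show "open b" if "b \<in> B" for b using that V by (auto simp: B_def intro!: open_translate)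
    fix S x assume S: "open S" "x \<in> (S :: 'g set)"
    \<comment> \<open>This map sends the pair of \<open>x + e\<close> and \<open>y + e\<close> to
      \<open>y\<close>. If both entries lie in a small enough \<open>V k\<close>, then
      \<open>y\<close> lies in \<open>S\<close>.\<close>
    have "open ((\<lambda>p. x - fst p + snd p) -` S)"
      by (intro open_vimage S continuous_intros)
    moreover have "(0, 0) \<in> (\<lambda>p. x - fst p + snd p) -` S" using S by simp
    ultimately obtain W1 W2 where W: "open W1" "open W2" "(0, 0) \<in> W1 \<times> W2" "W1 \<times> W2 \<subseteq> (\<lambda>p. x - fst p + snd p) -` S"
      by (rule open_prod_elim)
    obtain k where k: "V k \<subseteq> W1 \<inter> W2" using base[of "W1 \<inter> W2"] W by auto
    obtain e where e: "e \<in> E k" "x + e \<in> V k" using E(2)[of k] by blast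
    have "y \<in> S" if "y + e \<in> V k" for y
    proof -
      have "(x + e, y + e) \<in> W1 \<times> W2" using that k e by auto
      with W(4) have "x - (x + e) + (y + e) \<in> S" by fastforce
      then show ?thesis by simp
    qed
    then show "\<exists>b\<in>B. x \<in> b \<and> b \<subseteq> S"
      using e by (intro bexI[of _ "(\<lambda>x. x + e) -` V k"]) (auto simp: B_def)
  qed
  ultimately show ?thesis by blast
qed

end

section \<open>Finite approximation of the mean cost\<close>

text \<open>Reduces countably many labels to finitely many: all large labels are sent to one centre
  \<open>h0\<close> of finite mean cost, and the cost over the tail tends to 0 by dominated
  convergence. The cost \<open>c\<close> is abstract because this serves both \<open>\<rho>\<close>
  and its mean.\<close>

lemma (in prob_space) finite_truncation:
  fixes c :: "'b \<Rightarrow> 'a \<Rightarrow> ennreal" and \<kappa> :: "'a \<Rightarrow> nat"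
  assumes \<kappa>[measurable]: "\<kappa> \<in> measurable M (count_space UNIV)"
    and h: "AE z in M. c (h (\<kappa> z)) z \<le> \<delta>"
    and h0[measurable]: "c h0 \<in> borel_measurable M" and fin: "(\<integral>\<^sup>+z. c h0 z \<partial>M) < \<infinity>"
    and "t > 0"
  obtains N and \<iota> :: "'a \<Rightarrow> nat" where "\<iota> \<in> measurable M (count_space UNIV)" "\<And>z. \<iota> z \<le> N"
    "(\<integral>\<^sup>+z. c (case_nat h0 h (\<iota> z)) z \<partial>M) \<le> \<delta> + t"
proof -
  have "(\<lambda>n. \<integral>\<^sup>+z. c h0 z * indicator {z. n \<le> \<kappa> z} z \<partial>M) \<longlonglongrightarrow> (\<integral>\<^sup>+z. 0 \<partial>M)"
  proof (rule nn_integral_dominated_convergence[OF _ _ h0 _ fin])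
    show "AE x in M. (\<lambda>n. c h0 x * indicator {z. n \<le> \<kappa> z} x) \<longlonglongrightarrow> 0"
    proof (intro AE_I2 tendsto_eventually)
      fix x show "\<forall>\<^sub>F n in sequentially. c h0 x * indicator {z. n \<le> \<kappa> z} x = 0"
        using eventually_gt_at_top[of "\<kappa> x"] by eventually_elim simp
    qed
    show "AE x in M. c h0 x * indicator {z. n \<le> \<kappa> z} x \<le> c h0 x" for n
      by (intro AE_I2) (auto simp: indicator_def)
  qed auto
  then have "\<forall>\<^sub>F n in sequentially. (\<integral>\<^sup>+z. c h0 z * indicator {z. n \<le> \<kappa> z} z \<partial>M) < t"
    using \<open>t > 0\<close> by (intro order_tendstoD) auto
  then obtain n where n: "(\<integral>\<^sup>+z. c h0 z * indicator {z. n \<le> \<kappa> z} z \<partial>M) < t"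
    by (auto simp: eventually_sequentially)
  \<comment> \<open>Label 0 is reserved for \<open>h0\<close>, so the labels kept are shifted by
    one, in line with \<open>case_nat h0 h\<close>.\<close>
  define \<iota> where "\<iota> z = (if \<kappa> z < n then Suc (\<kappa> z) else 0)" for z
  show thesis
  proof (rule that[of \<iota> n])
    show "\<iota> \<in> measurable M (count_space UNIV)" unfolding \<iota>_def by measurable
    show "\<iota> z \<le> n" for z by (simp add: \<iota>_def)
    have "(\<integral>\<^sup>+z. c (case_nat h0 h (\<iota> z)) z \<partial>M) \<le> (\<integral>\<^sup>+z. \<delta> + c h0 z * indicator {z. n \<le> \<kappa> z} z \<partial>M)"
      using h by (intro nn_integral_mono_AE) (auto simp: \<iota>_def indicator_def)
    also have "\<dots> = \<delta> + (\<integral>\<^sup>+z. c h0 z * indicator {z. n \<le> \<kappa> z} z \<partial>M)"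
      by (subst nn_integral_add) (auto simp: emeasure_space_1)
    also have "\<dots> \<le> \<delta> + t" using n by (intro add_left_mono) simp
    finally show "(\<integral>\<^sup>+z. c (case_nat h0 h (\<iota> z)) z \<partial>M) \<le> \<delta> + t" .
  qed
qed

section \<open>Quantization with respect to an admissible semimetric\<close>

locale admissible_haar = haar_measure m for m :: "'g::{topological_ab_group_add,t2_space} measure" +
  fixes \<rho> :: "'g \<Rightarrow> 'g \<Rightarrow> real" and X :: "'g set"
  assumes admissible: "admissible_semimetric_on m \<rho> X"
begin

lemma X_sets [measurable]: "X \<in> sets borel"
  using admissible by (simp add: admissible_semimetric_on_def)

lemma AE_X: "AE x in m. x \<in> X"
  using admissible by (intro AE_I[of _ _ "- X"]) (auto simp: admissible_semimetric_on_def Compl_eq_Diff_UNIV)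

lemma AE_X_translate: "AE x in m. x + a \<in> X"
proof -
  have "AE x in distr m borel (\<lambda>x. x + a). x \<in> X" unfolding distr_translate by (rule AE_X)
  then show ?thesis by (subst (asm) AE_distr_iff) auto
qed

lemma X_nonempty: "X \<noteq> {}"
  using AE_X by (auto simp: AE_False)

lemma measurable_rho [measurable (raw)]:
  assumes "f \<in> borel_measurable M" "g \<in> borel_measurable M"
  shows "(\<lambda>x. \<rho> (f x) (g x)) \<in> borel_measurable M"
proof -
  have "case_prod \<rho> \<in> borel_measurable (m \<Otimes>\<^sub>M m)"
    using admissible by (simp add: admissible_semimetric_on_def)
  also have "measurable (m \<Otimes>\<^sub>M m) borel = measurable (borel \<Otimes>\<^sub>M borel) borel"
    by (intro measurable_cong_sets sets_pair_measure_cong) auto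
  finally have "(\<lambda>x. case_prod \<rho> (f x, g x)) \<in> borel_measurable M"
    using assms by measurable
  then show ?thesis by simp
qed

lemma rho_nonneg: "x \<in> X \<Longrightarrow> y \<in> X \<Longrightarrow> 0 \<le> \<rho> x y"
  and rho_commute: "x \<in> X \<Longrightarrow> y \<in> X \<Longrightarrow> \<rho> x y = \<rho> y x"
  and rho_triangle: "x \<in> X \<Longrightarrow> y \<in> X \<Longrightarrow> z \<in> X \<Longrightarrow> \<rho> x z \<le> \<rho> x y + \<rho> y z"
  and rho_refl: "x \<in> X \<Longrightarrow> \<rho> x x = 0"
  using admissible unfolding admissible_semimetric_on_def by auto

lemma nn_integral_rho_finite: "(\<integral>\<^sup>+x. \<integral>\<^sup>+y. ennreal (\<rho> x y) \<partial>m \<partial>m) < \<infinity>"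
proof -
  have int: "integrable (m \<Otimes>\<^sub>M m) (case_prod \<rho>)"
    using admissible by (simp add: admissible_semimetric_on_def)
  have "(\<integral>\<^sup>+x. \<integral>\<^sup>+y. ennreal (\<rho> x y) \<partial>m \<partial>m) = (\<integral>\<^sup>+z. ennreal (case_prod \<rho> z) \<partial>(m \<Otimes>\<^sub>M m))"
    by (subst nn_integral_fst[symmetric]) auto
  also have "\<dots> \<le> (\<integral>\<^sup>+z. ennreal (norm (case_prod \<rho> z)) \<partial>(m \<Otimes>\<^sub>M m))"
    by (intro nn_integral_mono ennreal_leI) auto
  also have "\<dots> < \<infinity>" using int by (simp add: integrable_iff_bounded)
  finally show ?thesis .
qed

text \<open>Admissibility gives a separable measure algebra, hence a countable basis, hence joint
  measurability of addition. This is what allows Fubini for costs of translated points.\<close>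

lemma measurable_add [measurable (raw)]:
  assumes "f \<in> borel_measurable M" "g \<in> borel_measurable M"
  shows "(\<lambda>x. f x + g x :: 'g) \<in> borel_measurable M"
proof -
  obtain A where "dense_in_measure_algebra m A"
    using admissible_imp_dense_in_measure_algebra[OF finite_measure_axioms admissible X_nonempty] by blast
  then obtain B :: "'g set set" where "countable B" "topological_basis B"
    using countable_basis_of_dense_sequence by blast
  then have "(\<lambda>p. fst p + snd p :: 'g) \<in> borel_measurable (borel \<Otimes>\<^sub>M borel)"
    by (rule borel_measurable_add_countable_basis)
  then have "(\<lambda>x. fst (f x, g x) + snd (f x, g x)) \<in> borel_measurable M"
    using assms by measurable
  then show ?thesis by simp
qed

lemma finite_approx:
  assumes "\<delta> > 0"
  obtains N and \<iota> :: "'g \<Rightarrow> nat" and e where "\<iota> \<in> measurable m (count_space UNIV)" "\<And>x. \<iota> x \<le> N"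
    "\<And>i. e i \<in> X" "(\<integral>\<^sup>+x. ennreal (\<rho> (e (\<iota> x)) x) \<partial>m) \<le> ennreal \<delta>"
proof -
  have "AE x in m. (\<integral>\<^sup>+y. ennreal (\<rho> x y) \<partial>m) \<noteq> \<infinity>"
    using nn_integral_rho_finite by (intro nn_integral_PInf_AE) auto
  then have "AE x in m. x \<in> X \<and> (\<integral>\<^sup>+y. ennreal (\<rho> x y) \<partial>m) \<noteq> \<infinity>"
    using AE_X by eventually_elim simp
  \<comment> \<open>A centre of finite mean cost, to which the truncation sends the tail.\<close>
  then obtain x0 where x0: "x0 \<in> X" "(\<integral>\<^sup>+y. ennreal (\<rho> x0 y) \<partial>m) \<noteq> \<infinity>"
    using eventually_happens'[OF ae_filter_bot] by blast
  obtain D where D: "D \<subseteq> X" "countable D" and dense: "\<And>x e. x \<in> X \<Longrightarrow> e > 0 \<Longrightarrow> \<exists>d\<in>D. \<rho> x d < e"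
    using admissible unfolding admissible_semimetric_on_def by auto
  have "D \<noteq> {}" using dense[of x0 1] x0 by auto
  define d where "d = from_nat_into D"
  have d: "d i \<in> X" for i using from_nat_into[OF \<open>D \<noteq> {}\<close>] D by (auto simp: d_def)
  have d_dense: "\<exists>i. \<rho> (d i) x < e" if "x \<in> X" "e > 0" for x e
    using dense[OF that] from_nat_into_surj[OF D(2)] D(1) rho_commute[OF that(1)] unfolding d_def by (metis subsetD)
  \<comment> \<open>Taking the first close point makes the choice measurable; outside the
    full-measure set \<open>X\<close> its value is irrelevant.\<close>
  define \<kappa> where "\<kappa> x = (LEAST i. \<rho> (d i) x < \<delta> / 2)" for x
  have \<kappa>_measurable: "\<kappa> \<in> measurable m (count_space UNIV)" unfolding \<kappa>_def by measurable
  have AE: "AE x in m. ennreal (\<rho> (d (\<kappa> x)) x) \<le> ennreal (\<delta> / 2)"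
    using AE_X
  proof eventually_elim
    case (elim x)
    have "\<rho> (d (\<kappa> x)) x < \<delta> / 2" unfolding \<kappa>_def
      by (rule LeastI_ex) (use d_dense[OF elim, of "\<delta> / 2"] assms in auto)
    then show ?case by (intro ennreal_leI) simp
  qed
  have meas: "(\<lambda>x. ennreal (\<rho> x0 x)) \<in> borel_measurable m" by measurable
  have fin: "(\<integral>\<^sup>+y. ennreal (\<rho> x0 y) \<partial>m) < \<infinity>" using x0 by (simp add: less_top[symmetric])
  have pos: "ennreal (\<delta> / 2) > 0" using assms by simp
  obtain N \<iota> where \<iota>: "\<iota> \<in> measurable m (count_space UNIV)" "\<And>x. \<iota> x \<le> N"
    "(\<integral>\<^sup>+x. ennreal (\<rho> (case_nat x0 d (\<iota> x)) x) \<partial>m) \<le> ennreal (\<delta> / 2) + ennreal (\<delta> / 2)"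
    by (rule finite_truncation[of \<kappa> "\<lambda>a x. ennreal (\<rho> a x)" d, OF \<kappa>_measurable AE meas fin pos]) (rule that)
  have "ennreal (\<delta> / 2) + ennreal (\<delta> / 2) = ennreal \<delta>" using assms by (simp flip: ennreal_plus)
  with \<iota> show thesis
    by (intro that[of \<iota> N "case_nat x0 d"]) (auto simp: x0 d split: nat.splits)
qed

text \<open>Each \<open>h\<close> is labelled by the first \<open>A i\<close> close to the translate
  of \<open>P\<close> by \<open>h\<close>; equal labels put two translates within twice that
  distance. For finitely many sets the labels are paired up.\<close>

lemma translates_countable_classes:
  assumes "finite \<P>" "\<P> \<subseteq> sets borel" "\<eta> > 0"
  obtains \<kappa> :: "'g \<Rightarrow> nat" where "\<kappa> \<in> measurable m (count_space UNIV)"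
    "\<And>h h' P. \<kappa> h = \<kappa> h' \<Longrightarrow> P \<in> \<P> \<Longrightarrow>
       (\<integral>\<^sup>+x. ennreal \<bar>indicator P (x + h) - indicator P (x + h')\<bar> \<partial>m) \<le> ennreal \<eta>"
proof -
  obtain A where A: "dense_in_measure_algebra m A"
    using admissible_imp_dense_in_measure_algebra[OF finite_measure_axioms admissible X_nonempty] by blast
  have [measurable]: "A i \<in> sets borel" for i
    using A by (auto simp: dense_in_measure_algebra_def)
  have "\<exists>\<kappa> :: 'g \<Rightarrow> nat. \<kappa> \<in> measurable m (count_space UNIV) \<and> (\<forall>h h'. \<kappa> h = \<kappa> h' \<longrightarrow> (\<forall>P\<in>\<P>.
       (\<integral>\<^sup>+x. ennreal \<bar>indicator P (x + h) - indicator P (x + h')\<bar> \<partial>m) \<le> ennreal \<eta>))"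
    using assms(1,2)
  proof (induction \<P> rule: finite_induct)
    case empty
    then show ?case by (auto intro!: exI[of _ "\<lambda>_. 0"])
  next
    case (insert P \<P>)
    then obtain \<kappa> :: "'g \<Rightarrow> nat" where \<kappa>[measurable]: "\<kappa> \<in> measurable m (count_space UNIV)" and
      \<kappa>': "\<And>h h' P. \<kappa> h = \<kappa> h' \<Longrightarrow> P \<in> \<P> \<Longrightarrow>
       (\<integral>\<^sup>+x. ennreal \<bar>indicator P (x + h) - indicator P (x + h')\<bar> \<partial>m) \<le> ennreal \<eta>" by auto
    have P[measurable]: "P \<in> sets borel" using insert by auto
    \<comment> \<open>Written as an integral, the distance is measurable in \<open>h\<close> because
      addition is jointly measurable.\<close>
    define D where "D h i = (\<integral>\<^sup>+x. ennreal \<bar>indicator P (x + h) - indicator (A i) x\<bar> \<partial>m)" for h i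
    have [measurable]: "(\<lambda>h. D h i) \<in> borel_measurable m" for i unfolding D_def by measurable
    define \<mu> where "\<mu> h = (LEAST i. D h i < ennreal (\<eta> / 2))" for h
    have [measurable]: "\<mu> \<in> measurable m (count_space UNIV)" unfolding \<mu>_def by measurable
    have \<mu>: "D h (\<mu> h) < ennreal (\<eta> / 2)" for h
      unfolding \<mu>_def
    proof (rule LeastI_ex)
      have [measurable]: "(\<lambda>x. x + h) -` P \<in> sets borel"
        using measurable_sets[OF measurable_translate P, of h] by simp
      obtain i where i: "measure m (sym_diff ((\<lambda>x. x + h) -` P) (A i)) < \<eta> / 2"
        using A assms(3) by (auto simp: dense_in_measure_algebra_def dest!: bspec[of _ _ "(\<lambda>x. x + h) -` P"] spec[of _ "\<eta>/2"])
      have "D h i = ennreal (measure m (sym_diff ((\<lambda>x. x + h) -` P) (A i)))"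
        unfolding D_def by (subst nn_integral_indicator_diff[symmetric]) (auto simp: indicator_def)
      with i assms show "\<exists>i. D h i < ennreal (\<eta> / 2)" by (auto intro!: exI[of _ i] ennreal_lessI)
    qed
    have close: "(\<integral>\<^sup>+x. ennreal \<bar>indicator P (x + h) - indicator P (x + h')\<bar> \<partial>m) \<le> ennreal \<eta>" if "\<mu> h = \<mu> h'" for h h'
    proof -
      have "(\<integral>\<^sup>+x. ennreal \<bar>indicator P (x + h) - indicator P (x + h')\<bar> \<partial>m) \<le> D h (\<mu> h) + D h' (\<mu> h')"
        using nn_integral_abs_diff_triangle[of "\<lambda>x. indicator P (x + h)" "indicator (A (\<mu> h))" "\<lambda>x. indicator P (x + h')"]
        by (simp add: D_def that abs_minus_commute)
      also have "\<dots> \<le> ennreal (\<eta> / 2) + ennreal (\<eta> / 2)" using \<mu> by (intro add_mono) (auto intro: less_imp_le)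
      also have "\<dots> = ennreal \<eta>" using assms by (simp flip: ennreal_plus)
      finally show ?thesis .
    qed
    show ?case
      by (intro exI[of _ "\<lambda>h. prod_encode (\<kappa> h, \<mu> h)"]) (auto simp: \<kappa>' close)
  qed
  with that show thesis by blast
qed

text \<open>The averaged cost F(a, b): it depends on the pair only up to a common
  translation.\<close>

definition mean_rho :: "'g \<Rightarrow> 'g \<Rightarrow> ennreal" where
  "mean_rho a b = (\<integral>\<^sup>+x. ennreal (\<rho> (x + a) (x + b)) \<partial>m)"

lemma measurable_mean_rho [measurable (raw)]:
  assumes [measurable]: "f \<in> borel_measurable M" "g \<in> borel_measurable M"
  shows "(\<lambda>x. mean_rho (f x) (g x)) \<in> borel_measurable M"
  unfolding mean_rho_def by measurable

lemma mean_rho_translate: "(\<integral>\<^sup>+x. ennreal (\<rho> (x + c + a) (x + c + b)) \<partial>m) = mean_rho a b"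
  unfolding mean_rho_def by (rule nn_integral_translate[where f="\<lambda>x. ennreal (\<rho> (x + a) (x + b))"]) measurable

lemma nn_integral_mean_rho_finite: "(\<integral>\<^sup>+z. mean_rho 0 z \<partial>m) < \<infinity>"
proof -
  interpret P: pair_sigma_finite m m by standard
  have "(\<integral>\<^sup>+z. mean_rho 0 z \<partial>m) = (\<integral>\<^sup>+x. \<integral>\<^sup>+z. ennreal (\<rho> x (x + z)) \<partial>m \<partial>m)"
    unfolding mean_rho_def add_0_right by (intro P.Fubini') measurable
  also have "\<dots> = (\<integral>\<^sup>+x. \<integral>\<^sup>+z. ennreal (\<rho> x z) \<partial>m \<partial>m)"
  proof (rule nn_integral_cong)
    fix x show "(\<integral>\<^sup>+z. ennreal (\<rho> x (x + z)) \<partial>m) = (\<integral>\<^sup>+z. ennreal (\<rho> x z) \<partial>m)"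
      using nn_integral_translate[of "\<lambda>z. ennreal (\<rho> x z)" x] by (simp add: add.commute)
  qed
  finally show ?thesis using nn_integral_rho_finite by simp
qed

text \<open>Both points are replaced by the centres of their cells in a finite partition. By
  invariance each replacement costs at most \<open>\<delta> / 3\<close> in the mean, and the centres
  differ only where the two translates of some cell differ, which is rare when \<open>h\<close> and
  \<open>h'\<close> share a label.\<close>

lemma mean_rho_countable_classes:
  assumes "\<delta> > 0"
  obtains \<kappa> :: "'g \<Rightarrow> nat" where "\<kappa> \<in> measurable m (count_space UNIV)"
    "\<And>h h'. \<kappa> h = \<kappa> h' \<Longrightarrow> mean_rho h h' \<le> ennreal \<delta>"
proof -
  have \<delta>3: "\<delta> / 3 > 0" using assms by simp
  obtain N and \<iota> :: "'g \<Rightarrow> nat" and e where \<iota>[measurable]: "\<iota> \<in> measurable m (count_space UNIV)" and \<iota>N: "\<And>x. \<iota> x \<le> N"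
    and e: "\<And>i. e i \<in> X" and \<iota>\<rho>: "(\<integral>\<^sup>+x. ennreal (\<rho> (e (\<iota> x)) x) \<partial>m) \<le> ennreal (\<delta> / 3)"
    by (rule finite_approx[OF \<delta>3]) (rule that)
  have [measurable]: "(\<lambda>x. e (\<iota> x)) \<in> borel_measurable borel"
    using measurable_compose[OF \<iota>, of e borel] by simp
  have \<iota>'[measurable]: "\<iota> \<in> measurable borel (count_space UNIV)"
    using \<iota> by simp
  define K where "K = (\<Sum>i\<le>N. \<Sum>j\<le>N. \<rho> (e i) (e j))"
  have K: "\<rho> (e i) (e j) \<le> K" if "i \<le> N" "j \<le> N" for i j
  proof -
    have "\<rho> (e i) (e j) \<le> (\<Sum>j\<le>N. \<rho> (e i) (e j))"
      using that e by (intro member_le_sum) (auto intro: rho_nonneg)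
    also have "\<dots> \<le> K" unfolding K_def
      using that e by (intro member_le_sum[of i _ "\<lambda>i. \<Sum>j\<le>N. \<rho> (e i) (e j)"]) (auto intro: rho_nonneg sum_nonneg)
    finally show ?thesis .
  qed
  have K0: "K \<ge> 0" unfolding K_def using e by (intro sum_nonneg) (auto intro: rho_nonneg)
  \<comment> \<open>Chosen so that (K + 1)(N + 1)\<open>\<eta>\<close> =
    \<open>\<delta> / 3\<close>; using K + 1 keeps the denominator positive.\<close>
  define \<eta> where "\<eta> = \<delta> / 3 / ((K + 1) * Suc N)"
  have \<eta>: "\<eta> > 0" using K0 assms by (simp add: \<eta>_def)
  define P where "P i = \<iota> -` {i}" for i
  have P[measurable]: "P i \<in> sets borel" for i
    using measurable_sets[OF \<iota>', of "{i}"] by (simp add: P_def)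
  obtain \<kappa> :: "'g \<Rightarrow> nat" where \<kappa>: "\<kappa> \<in> measurable m (count_space UNIV)"
    "\<And>h h' i. \<kappa> h = \<kappa> h' \<Longrightarrow> i \<le> N \<Longrightarrow>
       (\<integral>\<^sup>+x. ennreal \<bar>indicator (P i) (x + h) - indicator (P i) (x + h')\<bar> \<partial>m) \<le> ennreal \<eta>"
  proof (rule translates_countable_classes[of "P ` {..N}" \<eta>])
    fix \<kappa> :: "'g \<Rightarrow> nat"
    assume "\<kappa> \<in> measurable m (count_space UNIV)"
      and "\<And>h h' Q. \<kappa> h = \<kappa> h' \<Longrightarrow> Q \<in> P ` {..N} \<Longrightarrow>
        (\<integral>\<^sup>+x. ennreal \<bar>indicator Q (x + h) - indicator Q (x + h')\<bar> \<partial>m) \<le> ennreal \<eta>"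
    then show thesis by (intro that[of \<kappa>]) auto
  qed (use \<eta> in auto)
  have "mean_rho h h' \<le> ennreal \<delta>" if hh: "\<kappa> h = \<kappa> h'" for h h'
  proof -
    let ?\<phi> = "\<lambda>x. e (\<iota> x)"
    \<comment> \<open>Within one cell the left side vanishes; across cells it is at most
      \<open>K\<close>, while the sum is at least 1.\<close>
    have mid: "\<rho> (?\<phi> y) (?\<phi> z) \<le> (K + 1) * (\<Sum>i\<le>N. \<bar>indicator (P i) y - indicator (P i) z\<bar>)" for y z
    proof (cases "\<iota> y = \<iota> z")
      case True
      then show ?thesis using K0 rho_refl[OF e] by (auto intro!: mult_nonneg_nonneg sum_nonneg)
    next
      case False
      have "1 \<le> \<bar>indicator (P (\<iota> y)) y - indicator (P (\<iota> y)) z :: real\<bar>"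
        using False by (simp add: P_def)
      also have "\<dots> \<le> (\<Sum>i\<le>N. \<bar>indicator (P i) y - indicator (P i) z\<bar>)"
        using \<iota>N by (intro member_le_sum[of _ _ "\<lambda>i. \<bar>indicator (P i) y - indicator (P i) z\<bar>"]) auto
      finally have "K + 1 \<le> (K + 1) * (\<Sum>i\<le>N. \<bar>indicator (P i) y - indicator (P i) z\<bar>)"
        using K0 by simp
      with K[OF \<iota>N \<iota>N, of y z] show ?thesis by simp
    qed
    have "mean_rho h h' \<le> (\<integral>\<^sup>+x. ennreal (\<rho> (?\<phi> (x + h)) (x + h)) + (ennreal (K + 1) * (\<Sum>i\<le>N. ennreal \<bar>indicator (P i) (x + h) - indicator (P i) (x + h')\<bar>)
         + ennreal (\<rho> (?\<phi> (x + h')) (x + h'))) \<partial>m)"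
      unfolding mean_rho_def
    proof (intro nn_integral_mono_AE)
      show "AE x in m. ennreal (\<rho> (x + h) (x + h')) \<le> ennreal (\<rho> (?\<phi> (x + h)) (x + h))
         + (ennreal (K + 1) * (\<Sum>i\<le>N. ennreal \<bar>indicator (P i) (x + h) - indicator (P i) (x + h')\<bar>)
         + ennreal (\<rho> (?\<phi> (x + h')) (x + h')))"
        using AE_X_translate[of h] AE_X_translate[of h']
      proof eventually_elim
        case (elim x)
        have "\<rho> (x + h) (x + h') \<le> \<rho> (?\<phi> (x + h)) (x + h) + (\<rho> (?\<phi> (x + h)) (?\<phi> (x + h')) + \<rho> (?\<phi> (x + h')) (x + h'))"
          using rho_triangle[OF elim(1) e elim(2), of "\<iota> (x + h)"] rho_triangle[OF e e elim(2), of "\<iota> (x + h)" "\<iota> (x + h')"]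
            rho_commute[OF elim(1) e, of "\<iota> (x + h)"] by simp
        also have "\<dots> \<le> \<rho> (?\<phi> (x + h)) (x + h) + ((K + 1) * (\<Sum>i\<le>N. \<bar>indicator (P i) (x + h) - indicator (P i) (x + h')\<bar>)
           + \<rho> (?\<phi> (x + h')) (x + h'))"
          using mid[of "x + h" "x + h'"] by simp
        finally have "ennreal (\<rho> (x + h) (x + h')) \<le> ennreal (\<rho> (?\<phi> (x + h)) (x + h) + ((K + 1) * (\<Sum>i\<le>N. \<bar>indicator (P i) (x + h) - indicator (P i) (x + h')\<bar>)
           + \<rho> (?\<phi> (x + h')) (x + h')))" by (rule ennreal_leI)
        then show ?case
          using K0 rho_nonneg[OF e elim(1)] rho_nonneg[OF e elim(2)]
          by (simp add: ennreal_plus ennreal_mult sum_nonneg sum_ennreal)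
      qed
    qed
    also have "\<dots> = (\<integral>\<^sup>+x. ennreal (\<rho> (?\<phi> (x + h)) (x + h)) \<partial>m)
        + (ennreal (K + 1) * (\<Sum>i\<le>N. \<integral>\<^sup>+x. ennreal \<bar>indicator (P i) (x + h) - indicator (P i) (x + h')\<bar> \<partial>m)
        + (\<integral>\<^sup>+x. ennreal (\<rho> (?\<phi> (x + h')) (x + h')) \<partial>m))"
      by (simp add: nn_integral_add nn_integral_cmult nn_integral_sum del: sum_ennreal)
    also have "\<dots> \<le> ennreal (\<delta> / 3) + (ennreal (K + 1) * (\<Sum>i\<le>N. ennreal \<eta>) + ennreal (\<delta> / 3))"
    proof (intro add_mono mult_left_mono sum_mono \<kappa>(2)[OF hh])
      have "(\<integral>\<^sup>+x. ennreal (\<rho> (?\<phi> (x + a)) (x + a)) \<partial>m) \<le> ennreal (\<delta> / 3)" for a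
        using nn_integral_translate[of "\<lambda>x. ennreal (\<rho> (?\<phi> x) x)" a] \<iota>\<rho> by simp
      then show "(\<integral>\<^sup>+x. ennreal (\<rho> (?\<phi> (x + h)) (x + h)) \<partial>m) \<le> ennreal (\<delta> / 3)"
        "(\<integral>\<^sup>+x. ennreal (\<rho> (?\<phi> (x + h')) (x + h')) \<partial>m) \<le> ennreal (\<delta> / 3)" by auto
    qed auto
    also have "ennreal (K + 1) * (\<Sum>i\<le>N. ennreal \<eta>) = ennreal ((K + 1) * (\<Sum>i\<le>N. \<eta>))"
      using K0 \<eta> by (subst sum_ennreal) (auto simp: ennreal_mult')
    also have "(K + 1) * (\<Sum>i\<le>N. \<eta>) = \<delta> / 3"
    proof -
      have c: "(K + 1) * real (Suc N) \<noteq> 0" using K0 by simp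
      have "(K + 1) * (\<Sum>i\<le>N. \<eta>) = (K + 1) * real (Suc N) * \<eta>" by simp
      also have "\<dots> = \<delta> / 3"
        unfolding \<eta>_def using nonzero_divide_eq_eq[OF c] by (metis mult.commute)
      finally show ?thesis .
    qed
    also have "ennreal (\<delta> / 3) + (ennreal (\<delta> / 3) + ennreal (\<delta> / 3)) = ennreal \<delta>"
      using assms by (simp flip: ennreal_plus)
    finally show ?thesis .
  qed
  with \<kappa>(1) that show thesis by blast
qed

text \<open>One representative per class gives a countably valued approximation, which is truncated
  with default centre 0, whose mean cost is finite.\<close>

lemma mean_rho_finite_approx:
  assumes "\<delta> > 0"
  obtains N and \<iota> :: "'g \<Rightarrow> nat" and e where "\<iota> \<in> measurable m (count_space UNIV)" "\<And>z. \<iota> z \<le> N"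
    "(\<integral>\<^sup>+z. mean_rho (e (\<iota> z)) z \<partial>m) \<le> ennreal \<delta>"
proof -
  obtain \<kappa> :: "'g \<Rightarrow> nat" where \<kappa>[measurable]: "\<kappa> \<in> measurable m (count_space UNIV)"
    and close: "\<And>h h'. \<kappa> h = \<kappa> h' \<Longrightarrow> mean_rho h h' \<le> ennreal (\<delta> / 2)"
    using mean_rho_countable_classes[of "\<delta> / 2"] assms by auto
  define h where "h i = (SOME h. \<kappa> h = i)" for i
  have "\<kappa> (h (\<kappa> z)) = \<kappa> z" for z unfolding h_def by (rule someI[of _ z]) simp
  then have AE: "AE z in m. mean_rho (h (\<kappa> z)) z \<le> ennreal (\<delta> / 2)" by (intro AE_I2 close)
  have meas: "mean_rho 0 \<in> borel_measurable m" by measurable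
  have pos: "ennreal (\<delta> / 2) > 0" using assms by simp
  obtain N \<iota> where \<iota>: "\<iota> \<in> measurable m (count_space UNIV)" "\<And>x. \<iota> x \<le> N"
    "(\<integral>\<^sup>+x. mean_rho (case_nat 0 h (\<iota> x)) x \<partial>m) \<le> ennreal (\<delta> / 2) + ennreal (\<delta> / 2)"
    by (rule finite_truncation[OF \<kappa> AE meas nn_integral_mean_rho_finite pos]) (rule that)
  have "ennreal (\<delta> / 2) + ennreal (\<delta> / 2) = ennreal \<delta>" using assms by (simp flip: ennreal_plus)
  with \<iota> show thesis
    by (intro that[of \<iota> N "case_nat 0 h"]) auto
qed

end

section \<open>Entropy of the averaged metrics\<close>

lemma (in prob_space) pmf_of_countable_valued:
  fixes \<iota> :: "'a \<Rightarrow> 'b::countable"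
  assumes [measurable]: "\<iota> \<in> measurable M (count_space UNIV)"
  obtains q where "measure_pmf q = distr M (count_space UNIV) \<iota>"
proof -
  interpret D: prob_space "distr M (count_space UNIV) \<iota>" by (rule prob_space_distr) measurable
  have "AE x in distr M (count_space UNIV) \<iota>. measure (distr M (count_space UNIV) \<iota>) {x} \<noteq> 0"
    by (subst D.AE_support_countable) (auto intro!: exI[of _ UNIV])
  then have "measure_pmf (Abs_pmf (distr M (count_space UNIV) \<iota>)) = distr M (count_space UNIV) \<iota>"
    by (intro pmf.Abs_pmf_inverse) (simp add: D.prob_space_axioms)
  with that show thesis .
qed

text \<open>The inequality ln t \<le> t - 1 at t = 1/p gives -p ln p \<le> 1 - p, so each atom
  contributes at most 1.\<close>

lemma entropy_pmf_le_card:
  assumes "finite (set_pmf p)"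
  shows "entropy_pmf p \<le> ennreal (card (set_pmf p))"
proof -
  have "- pmf p x * ln (pmf p x) \<le> 1" if "x \<in> set_pmf p" for x
  proof -
    have pos: "pmf p x > 0" using that by (simp add: pmf_positive)
    have "- ln (pmf p x) \<le> 1 / pmf p x - 1"
      using ln_le_minus_one[of "1 / pmf p x"] pos by (simp add: ln_div)
    then have "pmf p x * - ln (pmf p x) \<le> pmf p x * (1 / pmf p x - 1)"
      using pos by (intro mult_left_mono) auto
    also have "\<dots> \<le> 1" using pos by (simp add: algebra_simps)
    finally show ?thesis by simp
  qed
  then have "entropy_pmf p \<le> (\<integral>\<^sup>+x. 1 \<partial>count_space (set_pmf p))"
    unfolding entropy_pmf_def by (intro nn_integral_mono) (auto simp flip: ennreal_1 intro!: ennreal_leI)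
  also have "\<dots> = ennreal (card (set_pmf p))"
    using assms by (simp add: emeasure_count_space_finite ennreal_of_nat_eq_real_of_nat)
  finally show ?thesis .
qed

text \<open>The joint law of \<open>f\<close> and \<open>g\<close> is a coupling of their
  laws.\<close>

lemma kantorovich_le_nn_integral:
  assumes f[measurable]: "f \<in> measurable M m" and g[measurable]: "g \<in> measurable M m" and sets: "sets \<mu> = sets m"
    and \<mu>: "\<mu> = distr M m f" and m: "m = distr M m g"
    and \<theta>: "(\<lambda>z. \<theta> (fst z) (snd z)) \<in> borel_measurable (m \<Otimes>\<^sub>M m)"
  shows "kantorovich \<theta> \<mu> m \<le> (\<integral>\<^sup>+x. ennreal (\<theta> (f x) (g x)) \<partial>M)"
proof -
  define \<pi> where "\<pi> = distr M (m \<Otimes>\<^sub>M m) (\<lambda>x. (f x, g x))"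
  have "\<pi> \<in> couplings \<mu> m"
    unfolding couplings_def
  proof (intro CollectI conjI)
    show "sets \<pi> = sets (\<mu> \<Otimes>\<^sub>M m)"
      by (simp add: \<pi>_def cong: sets_pair_measure_cong[OF sets refl])
    have "distr \<pi> \<mu> fst = distr \<pi> m fst" by (intro distr_cong sets) auto
    also have "\<dots> = distr M m f" unfolding \<pi>_def by (subst distr_distr) (auto simp: comp_def)
    finally show "distr \<pi> \<mu> fst = \<mu>" by (simp add: \<mu>)
    have "distr \<pi> m snd = distr M m g" unfolding \<pi>_def by (subst distr_distr) (auto simp: comp_def)
    then show "distr \<pi> m snd = m" using m by simp
  qed
  then have "kantorovich \<theta> \<mu> m \<le> (\<integral>\<^sup>+z. ennreal (\<theta> (fst z) (snd z)) \<partial>\<pi>)"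
    unfolding kantorovich_def by (rule INF_lower)
  also have "\<dots> = (\<integral>\<^sup>+x. ennreal (\<theta> (f x) (g x)) \<partial>M)"
    unfolding \<pi>_def using \<theta> by (subst nn_integral_distr) auto
  finally show ?thesis .
qed

text \<open>\<open>ennreal\<close> cuts negative terms to 0. Only the inequality is available for
  orbit sums, since \<open>\<rho>\<close> may be negative off \<open>X\<close>.\<close>

lemma ennreal_sum_le: "ennreal (\<Sum>i\<in>I. f i) \<le> (\<Sum>i\<in>I. ennreal (f i))"
proof -
  have "ennreal (\<Sum>i\<in>I. f i) \<le> ennreal (\<Sum>i\<in>I. max 0 (f i))"
    by (intro ennreal_leI sum_mono) simp
  also have "\<dots> = (\<Sum>i\<in>I. ennreal (f i))"
    by (subst sum_ennreal[symmetric]) (auto simp: ennreal_max_0)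
  finally show ?thesis .
qed

section \<open>Bounds for the averaged metrics, uniform in their length\<close>

context admissible_haar
begin

lemma translation_funpow: "((\<lambda>x. x + g) ^^ k) x = x + ((\<lambda>x. x + g) ^^ k) (0::'g)"
  by (induction k) (simp_all add: add.assoc)

lemma measurable_avg [measurable (raw)]:
  assumes [measurable]: "f \<in> borel_measurable M" "h \<in> borel_measurable M"
  shows "(\<lambda>x. avg_metric (\<lambda>x. x + g) \<rho> n (f x) (h x)) \<in> borel_measurable M"
proof -
  have [measurable]: "((\<lambda>x. x + g) ^^ k) \<in> borel_measurable borel" for k
    by (subst translation_funpow[abs_def]) (rule measurable_translate)
  show ?thesis unfolding avg_metric_def by measurable
qed

text \<open>The k-th iterate is translation by the k-th orbit point of 0, which invariance of
  \<open>m\<close> absorbs. All \<open>n\<close> summands have the same integral bound, and the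
  factor 1/n cancels their number.\<close>

lemma nn_integral_avg_le_mean_rho:
  assumes "n \<ge> 1"
  shows "(\<integral>\<^sup>+y. ennreal (avg_metric (\<lambda>x. x + g) \<rho> n (y + a) (y + b)) \<partial>m) \<le> mean_rho a b"
proof -
  let ?c = "\<lambda>k. ((\<lambda>x. x + g) ^^ k) 0"
  have "ennreal (avg_metric (\<lambda>x. x + g) \<rho> n (y + a) (y + b))
      \<le> ennreal (1 / n) * (\<Sum>k<n. ennreal (\<rho> (y + ?c k + a) (y + ?c k + b)))" for y
  proof -
    have *: "((\<lambda>x. x + g) ^^ k) (y + d) = y + ?c k + d" for k d
      by (subst translation_funpow) (simp add: ac_simps)
    show ?thesis unfolding avg_metric_def *
      by (subst ennreal_mult') (auto intro!: mult_left_mono ennreal_sum_le)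
  qed
  then have "(\<integral>\<^sup>+y. ennreal (avg_metric (\<lambda>x. x + g) \<rho> n (y + a) (y + b)) \<partial>m)
      \<le> (\<integral>\<^sup>+y. ennreal (1 / n) * (\<Sum>k<n. ennreal (\<rho> (y + ?c k + a) (y + ?c k + b))) \<partial>m)"
    by (intro nn_integral_mono)
  also have "\<dots> = ennreal (1 / n) * (\<Sum>k<n. mean_rho a b)"
    by (subst nn_integral_cmult, measurable, subst nn_integral_sum, measurable) (simp add: mean_rho_translate)
  also have "\<dots> = ennreal (1 / n) * ennreal n * mean_rho a b"
    by (simp add: ennreal_of_nat_eq_real_of_nat mult.assoc)
  also have "ennreal (1 / n) * ennreal n = 1"
    using assms by (subst ennreal_mult[symmetric]) auto
  finally show ?thesis by simp
qed

text \<open>The labels and centres are fixed before \<open>n\<close>. Only the translation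
  \<open>y\<close> depends on \<open>n\<close>, and it does not affect the bound
  \<open>Suc N\<close> on the number of atoms.\<close>

lemma eps_entropy_avg_bounded:
  assumes "\<epsilon> > 0"
  shows "\<exists>C::real. \<forall>n\<ge>1. eps_entropy (avg_metric (\<lambda>x. x + g) \<rho> n) \<epsilon> m \<le> ennreal C"
proof -
  have \<epsilon>2: "\<epsilon> / 2 > 0" using assms by simp
  obtain N and \<iota> :: "'g \<Rightarrow> nat" and e where \<iota>[measurable]: "\<iota> \<in> measurable m (count_space UNIV)" and \<iota>N: "\<And>z. \<iota> z \<le> N"
    and close: "(\<integral>\<^sup>+z. mean_rho (e (\<iota> z)) z \<partial>m) \<le> ennreal (\<epsilon> / 2)"
    by (rule mean_rho_finite_approx[OF \<epsilon>2]) (rule that)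
  have e[measurable]: "(\<lambda>x. e (\<iota> x)) \<in> borel_measurable borel"
    using measurable_compose[OF \<iota>, of e borel] by simp
  obtain q where q: "measure_pmf q = distr m (count_space UNIV) \<iota>"
    using pmf_of_countable_valued[OF \<iota>] .
  have "set_pmf q \<subseteq> {..N}"
  proof
    fix i assume "i \<in> set_pmf q"
    then have "measure m (\<iota> -` {i}) \<noteq> 0"
      by (simp add: set_pmf.rep_eq q measure_distr)
    then show "i \<in> {..N}" using \<iota>N by (cases "\<iota> -` {i} = {}") auto
  qed
  have "eps_entropy (avg_metric (\<lambda>x. x + g) \<rho> n) \<epsilon> m \<le> ennreal (Suc N)" if "n \<ge> 1" for n
  proof -
    let ?\<theta> = "avg_metric (\<lambda>x. x + g) \<rho> n"
    interpret P: pair_sigma_finite m m by standard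
    have "(\<integral>\<^sup>+y. \<integral>\<^sup>+z. ennreal (?\<theta> (y + e (\<iota> z)) (y + z)) \<partial>m \<partial>m)
        = (\<integral>\<^sup>+z. \<integral>\<^sup>+y. ennreal (?\<theta> (y + e (\<iota> z)) (y + z)) \<partial>m \<partial>m)"
      by (rule P.Fubini'[symmetric]) measurable
    also have "\<dots> \<le> (\<integral>\<^sup>+z. mean_rho (e (\<iota> z)) z \<partial>m)"
      by (intro nn_integral_mono nn_integral_avg_le_mean_rho that)
    also have "\<dots> \<le> ennreal (\<epsilon> / 2)" by fact
    also have "\<dots> < ennreal \<epsilon>" using assms by (intro ennreal_lessI) auto
    finally have less: "(\<integral>\<^sup>+y. \<integral>\<^sup>+z. ennreal (?\<theta> (y + e (\<iota> z)) (y + z)) \<partial>m \<partial>m) < ennreal \<epsilon>" .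
    \<comment> \<open>The mean over \<open>y\<close> is below \<open>\<epsilon>\<close> and
      \<open>m\<close> is a probability measure, so some \<open>y\<close> attains a value below
      \<open>\<epsilon>\<close>.\<close>
    have "\<exists>y. (\<integral>\<^sup>+z. ennreal (?\<theta> (y + e (\<iota> z)) (y + z)) \<partial>m) < ennreal \<epsilon>"
    proof (rule ccontr)
      assume "\<not> ?thesis"
      then have "(\<integral>\<^sup>+y. ennreal \<epsilon> \<partial>m) \<le> (\<integral>\<^sup>+y. \<integral>\<^sup>+z. ennreal (?\<theta> (y + e (\<iota> z)) (y + z)) \<partial>m \<partial>m)"
        by (intro nn_integral_mono) (auto simp: not_less)
      with less show False using emeasure_space_1 by simp
    qed
    then obtain y where y: "(\<integral>\<^sup>+z. ennreal (?\<theta> (y + e (\<iota> z)) (y + z)) \<partial>m) < ennreal \<epsilon>" ..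
    define p where "p = map_pmf (\<lambda>i. y + e i) q"
    have set_p: "set_pmf p \<subseteq> (\<lambda>i. y + e i) ` {..N}"
      using \<open>set_pmf q \<subseteq> {..N}\<close> by (auto simp: p_def)
    have fin: "finite (set_pmf p)" using set_p by (rule finite_subset) simp
    have "card (set_pmf p) \<le> Suc N"
      using card_mono[OF _ set_p] card_image_le[of "{..N}" "\<lambda>i. y + e i"] by simp
    then have ent: "entropy_pmf p \<le> ennreal (Suc N)"
      using entropy_pmf_le_card[OF fin] by (elim order_trans) (intro ennreal_leI, simp)
    have "discrete_on m p = distr m m (\<lambda>z. y + e (\<iota> z))"
      unfolding discrete_on_def p_def map_pmf_rep_eq q
      by (subst distr_distr, simp, simp, subst distr_distr) (auto simp: comp_def)
    \<comment> \<open>Invariance gives the second marginal, so \<open>z\<close> mapped to the pair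
      of \<open>y + e (\<iota> z)\<close> and \<open>y + z\<close> induces a coupling of the
      discrete law with \<open>m\<close>.\<close>
    moreover have "distr m m (\<lambda>z. y + z) = m"
      using distr_translate[of y] distr_cong[OF refl sets_m, of m "\<lambda>z. y + z" "\<lambda>z. z + y"] by (simp add: add.commute)
    ultimately have "kantorovich ?\<theta> (discrete_on m p) m \<le> (\<integral>\<^sup>+z. ennreal (?\<theta> (y + e (\<iota> z)) (y + z)) \<partial>m)"
      by (intro kantorovich_le_nn_integral) (auto simp: discrete_on_def)
    with y have "kantorovich ?\<theta> (discrete_on m p) m < ennreal \<epsilon>" by simp
    moreover have "entropy_pmf p < \<infinity>" using ent by (rule le_less_trans) simp
    ultimately have "eps_entropy ?\<theta> \<epsilon> m \<le> entropy_pmf p"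
      unfolding eps_entropy_def by (intro INF_lower) simp
    with ent show ?thesis by (rule order_trans[rotated])
  qed
  then show ?thesis by blast
qed

end

theorem theorem5:
  fixes m :: "'g::{topological_ab_group_add,t2_space} measure"
    and g :: 'g and \<rho> :: "'g \<Rightarrow> 'g \<Rightarrow> real"
  assumes "haar_prob m"
    and "ergodic_map m (\<lambda>x. x + g)"
    and "admissible_metric m \<rho>"
    and "(\<exists>B. \<forall>x y. \<rho> x y \<le> B) \<or>
         admissible_semimetric m (limit_avg_metric (\<lambda>x. x + g) \<rho>)"
  shows "\<forall>\<epsilon>>0. \<exists>C::real. \<forall>n\<ge>1.
           eps_entropy (avg_metric (\<lambda>x. x + g) \<rho> n) \<epsilon> m \<le> ennreal C"
proof -
  obtain X where "admissible_semimetric_on m \<rho> X"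
    using assms(3) unfolding admissible_metric_def by blast
  then interpret admissible_haar m \<rho> X
    using assms(1) by unfold_locales
  show ?thesis using eps_entropy_avg_bounded by blast
qed

end
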